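(* Let $A\in\mathbb{C}^{3\times3}$ have eigenvalues $\lambda_1,\lambda_2,\lambda_3$, with $t_1(A)\neq0$, and put $\chi:=\operatorname{tr}A-\frac{t_2(A)}{t_1(A)}$. Then any line connecting $\chi$ with some eigenvalue $\lambda_j$, $j=1,2,3$, is a tangent of the curve $\det(p(A))=0$. Moreover, these three lines are the only tangents of $\det(p(A))=0$ that pass through $\chi$.
   Context: For an oriented line with unit direction $(\cos\theta,\sin\theta)$ through a point $x+iy$, its tangential angle is $\theta$ and its pedal coordinate with respect to the origin is $p:=x\sin\theta-y\cos\theta$. For $a\in\mathbb{C}$, $p(a):=p+\cos\theta\,\operatorname{Im}a-\sin\theta\,\operatorname{Re}a$ (the signed distance of $a$ to the line, so the line passes through $a$ iff $p(a)=0$). For a matrix $A$, $p(A):=pI+\cos\theta\,\operatorname{Im}A-\sin\theta\,\operatorname{Re}A$ with $\operatorname{Re}A=\frac{A+A^\star}{2}$, $\operatorname{Im}A=\frac{A-A^\star}{2i}$. A line is a tangent of the curve $\det(p(A))=0$ if its $(p,\theta)$ satisfies $\det(p(A))=0$. $t_k(A):=\operatorname{tr}(A^kA^\star)-\sum_j\lambda_j^k\bar\lambda_j$. *)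

theory Defs
  imports
    "HOL-Computational_Algebra.Polynomial"
    "Jordan_Normal_Form.Determinant"
    "Jordan_Normal_Form.Char_Poly"
    "Jordan_Normal_Form.Schur_Decomposition"
begin

definition mat_trace :: "complex mat \<Rightarrow> complex" where
  "mat_trace A = (\<Sum>i<dim_row A. A $$ (i, i))"

definition re_mat :: "complex mat \<Rightarrow> complex mat" where
  "re_mat A = (1 / 2) \<cdot>\<^sub>m (A + mat_adjoint A)"

definition im_mat :: "complex mat \<Rightarrow> complex mat" where
  "im_mat A = (1 / (2 * \<i>)) \<cdot>\<^sub>m (A - mat_adjoint A)"

text \<open>Eigenvalues are counted with algebraic multiplicity.\<close>

definition eigenvals :: "complex mat \<Rightarrow> complex multiset" where
  "eigenvals A = proots (char_poly A)"

definition t_inv :: "nat \<Rightarrow> complex mat \<Rightarrow> complex" where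
  "t_inv k A = mat_trace (A ^\<^sub>m k * mat_adjoint A) - (\<Sum>l\<in>#eigenvals A. l ^ k * cnj l)"

text \<open>
  An oriented line is given by a point \<open>z\<close> on it and its tangential angle \<open>\<theta>\<close>;
  the pedal coordinate \<open>pedal z \<theta>\<close> depends only on the oriented line, not on the choice of \<open>z\<close>.
\<close>

definition line_points :: "complex \<Rightarrow> real \<Rightarrow> complex set" where
  "line_points z \<theta> = {z + complex_of_real s * cis \<theta> | s. True}"

definition pedal :: "complex \<Rightarrow> real \<Rightarrow> real" where
  "pedal z \<theta> = Re z * sin \<theta> - Im z * cos \<theta>"

definition pedal_mat :: "real \<Rightarrow> real \<Rightarrow> complex mat \<Rightarrow> complex mat" where
  "pedal_mat p \<theta> A =
     complex_of_real p \<cdot>\<^sub>m 1\<^sub>m (dim_row A) + complex_of_real (cos \<theta>) \<cdot>\<^sub>m im_mat A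
       - complex_of_real (sin \<theta>) \<cdot>\<^sub>m re_mat A"

text \<open>
  The curve \<open>det (p(A)) = 0\<close> is a curve in line coordinates: it is given by its tangents, so the
  equation on the coordinates \<open>(p, \<theta>)\<close> of a line is what being a tangent means.
\<close>

definition is_tangent :: "complex mat \<Rightarrow> complex \<Rightarrow> real \<Rightarrow> bool" where
  "is_tangent A z \<theta> \<longleftrightarrow> det (pedal_mat (pedal z \<theta>) \<theta> A) = 0"

end

(* With B = A - chi I, the matrix p(A) of a line of angle theta through chi is
   (cis(-theta) B - cis(theta) B^star) / (2i). The coefficients of det (x B + y B^star) are det B,
   tr(adj(B) B^star) and their conjugates; by Cayley-Hamilton adj(B) = B^2 - (tr B) B + e_2 I, so
   this determinant differs from the one of the diagonal matrix of eigenvalues of B only by the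
   quantity D(B) = t_2(B) - (tr B) t_1(B) and its conjugate. The point chi is chosen so that D(B) = 0:
   then det p(A) is the product of the signed distances of the eigenvalues to the line. *)
theory Submission
  imports Defs
begin

section \<open>Coordinate formulas for 3-by-3 matrices and adjoints\<close>

lemma det_3:
  fixes A :: "'a :: comm_ring_1 mat"
  assumes "A \<in> carrier_mat 3 3"
  shows "det A =
      A $$ (0,0) * (A $$ (1,1) * A $$ (2,2) - A $$ (1,2) * A $$ (2,1))
    - A $$ (0,1) * (A $$ (1,0) * A $$ (2,2) - A $$ (1,2) * A $$ (2,0))
    + A $$ (0,2) * (A $$ (1,0) * A $$ (2,1) - A $$ (1,1) * A $$ (2,0))"
proof -
  have det2: "det B = B $$ (0,0) * B $$ (1,1) - B $$ (0,1) * B $$ (1,0)"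
    if "B \<in> carrier_mat 2 2" for B :: "'a mat"
    using that
    by (subst laplace_expansion_row[OF that, of 0], simp)
       (auto simp: numeral_2_eq_2 cofactor_def mat_delete_def det_single)
  show ?thesis
    using assms
    by (subst laplace_expansion_row[OF assms, of 0], simp)
       (auto simp: numeral_3_eq_3 numeral_2_eq_2 cofactor_def mat_delete_def
          det2[unfolded numeral_2_eq_2] algebra_simps)
qed

lemma mat_adjoint_carrier_square [simp]:
  "A \<in> carrier_mat n n \<Longrightarrow> mat_adjoint A \<in> carrier_mat n n"
  unfolding mat_adjoint_def by auto

lemma mat_adjoint_index:
  fixes A :: "complex mat"
  assumes "A \<in> carrier_mat n n" "i < n" "j < n"
  shows "mat_adjoint A $$ (i, j) = cnj (A $$ (j, i))"
  using assms unfolding mat_adjoint_def by (simp add: mat_of_rows_index)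

lemma mat_trace_3:
  assumes "A \<in> carrier_mat 3 3"
  shows "mat_trace A = A $$ (0,0) + A $$ (1,1) + A $$ (2,2)"
  using assms unfolding mat_trace_def by (simp add: numeral_3_eq_3 numeral_2_eq_2)

lemma mult_mat_index_3:
  fixes A B :: "'a :: comm_ring_1 mat"
  assumes "A \<in> carrier_mat 3 3" "B \<in> carrier_mat 3 3" "i < 3" "j < 3"
  shows "(A * B) $$ (i, j) =
    A $$ (i,0) * B $$ (0,j) + A $$ (i,1) * B $$ (1,j) + A $$ (i,2) * B $$ (2,j)"
  using assms by (simp add: scalar_prod_def numeral_3_eq_3 numeral_2_eq_2)

section \<open>Eigenvalues, translation by a scalar, and Vieta's formulas\<close>

lemma char_poly_eigenvals:
  assumes "A \<in> carrier_mat n n"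
  shows "char_poly A = (\<Prod>l\<in>#eigenvals A. [:-l, 1:])"
  using complex_poly_decompose_multiset[of "char_poly A"] degree_monic_char_poly[OF assms]
  unfolding eigenvals_def by simp

lemma poly_char_poly:
  fixes A :: "'a :: field mat"
  assumes "A \<in> carrier_mat n n"
  shows "poly (char_poly A) x = det (x \<cdot>\<^sub>m 1\<^sub>m n - A)"
proof -
  have "- char_matrix A x = x \<cdot>\<^sub>m 1\<^sub>m n - A"
    using assms by (intro eq_matI) (auto simp: char_matrix_def)
  then show ?thesis
    using char_poly_matrix[OF assms] by simp
qed

text \<open>Subtracting \<open>c\<close> translates the argument of the characteristic polynomial by
  \<open>c\<close>. The polynomials are compared as functions, and the roots are then read off the
  linear factors, which keeps multiplicities.\<close>

lemma eigenvals_shift: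
  assumes A: "A \<in> carrier_mat n n"
  shows "eigenvals (A - c \<cdot>\<^sub>m 1\<^sub>m n) = {#l - c. l \<in># eigenvals A#}"
proof -
  let ?B = "A - c \<cdot>\<^sub>m 1\<^sub>m n"
  have B: "?B \<in> carrier_mat n n"
    using A by auto
  have "poly (char_poly ?B) x = poly (\<Prod>l\<in>#eigenvals A. [:-(l - c), 1:]) x" for x
  proof -
    have "x \<cdot>\<^sub>m 1\<^sub>m n - ?B = (x + c) \<cdot>\<^sub>m 1\<^sub>m n - A"
      using A by (intro eq_matI) auto
    then have "poly (char_poly ?B) x = poly (char_poly A) (x + c)"
      by (simp add: poly_char_poly[OF A] poly_char_poly[OF B])
    also have "\<dots> = poly (\<Prod>l\<in>#eigenvals A. [:-(l - c), 1:]) x"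
      by (simp add: char_poly_eigenvals[OF A] poly_prod_mset image_mset.compositionality
            o_def algebra_simps)
    finally show ?thesis .
  qed
  then have "char_poly ?B = (\<Prod>l\<in>#eigenvals A. [:-(l - c), 1:])"
    by (simp add: poly_eq_poly_eq_iff[symmetric] fun_eq_iff)
  moreover have "proots (\<Prod>l\<in>#M. [:-(l - c), 1:]) = {#l - c. l \<in># M#}" for M
  proof (induction M)
    case (add l M)
    \<comment> \<open>The roots of a product are the union of the roots of its factors only when the
      product is nonzero, which \<open>proots_mult\<close> requires.\<close>
    have "(\<Prod>l\<in>#M. [:-(l - c), 1:]) \<noteq> 0"
      by (auto simp: prod_mset_zero_iff)
    then show ?case
      by (simp only: image_mset_add_mset prod_mset.add_mset proots_mult add.IH proots_linear_factor
          pCons_eq_0_iff one_neq_zero simp_thms if_False) simp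
  qed simp
  ultimately show ?thesis
    unfolding eigenvals_def by simp
qed

text \<open>Vieta: the factored characteristic polynomial and the expanded determinant of
  \<open>x I - A\<close> are the same cubic.\<close>

lemma sum_prod_roots_3:
  assumes A: "A \<in> carrier_mat 3 3" and ev: "eigenvals A = {#l1, l2, l3#}"
  shows "l1 + l2 + l3 = mat_trace A"
    and "l1 * l2 + l1 * l3 + l2 * l3 =
      A $$ (0,0) * A $$ (1,1) - A $$ (0,1) * A $$ (1,0) +
      A $$ (0,0) * A $$ (2,2) - A $$ (0,2) * A $$ (2,0) +
      A $$ (1,1) * A $$ (2,2) - A $$ (1,2) * A $$ (2,1)"
      (is "?e2 = ?E2")
    and "l1 * l2 * l3 = det A"
proof -
  let ?e1 = "l1 + l2 + l3" and ?e3 = "l1 * l2 * l3"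
  have char: "x ^ 3 - ?e1 * x ^ 2 + ?e2 * x - ?e3 = x ^ 3 - mat_trace A * x ^ 2 + ?E2 * x - det A" for x
  proof -
    have "poly (char_poly A) x = (x - l1) * (x - l2) * (x - l3)"
      by (simp add: char_poly_eigenvals[OF A] ev algebra_simps)
    moreover have "poly (char_poly A) x = x ^ 3 - mat_trace A * x ^ 2 + ?E2 * x - det A"
      using A unfolding poly_char_poly[OF A]
      by (subst det_3) (auto simp: det_3[OF A] mat_trace_3[OF A] power2_eq_square power3_eq_cube algebra_simps)
    ultimately show ?thesis
      by (simp add: algebra_simps power2_eq_square power3_eq_cube)
  qed
  \<comment> \<open>The leading terms agree, so the values at 0, 1 and -1 determine the remaining
    three coefficients.\<close>
  show e3: "?e3 = det A"
    using char[of 0] by simp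
  have plus: "- ?e1 + ?e2 = - mat_trace A + ?E2"
    using char[of 1] unfolding e3 by (simp add: algebra_simps)
  have minus: "- ?e1 - ?e2 = - mat_trace A - ?E2"
    using char[of "-1"] unfolding e3 by (simp add: algebra_simps)
  have "?e1 = - ((- ?e1 + ?e2) + (- ?e1 - ?e2)) / 2"
    by (simp add: algebra_simps)
  also have "\<dots> = mat_trace A"
    unfolding plus minus by (simp add: algebra_simps)
  finally show e1: "?e1 = mat_trace A" .
  show "?e2 = ?E2"
    using plus unfolding e1 by (simp add: algebra_simps)
qed

section \<open>The pencil of a matrix and its adjoint, and its behaviour under translation\<close>

lemma det_pencil_adjoint:
  assumes A: "A \<in> carrier_mat 3 3" and ev: "eigenvals A = {#l1, l2, l3#}"
  defines "D \<equiv> t_inv 2 A - mat_trace A * t_inv 1 A"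
  shows "det (x \<cdot>\<^sub>m A + y \<cdot>\<^sub>m mat_adjoint A) =
    (x * l1 + y * cnj l1) * (x * l2 + y * cnj l2) * (x * l3 + y * cnj l3)
    + x * y * (x * D + y * cnj D)"
proof -
  let ?H = "mat_adjoint A"
  define e2 where "e2 = l1 * l2 + l1 * l3 + l2 * l3"
  \<comment> \<open>By Cayley-Hamilton \<open>M\<close> is the trace of the adjugate of
    \<open>A\<close> times \<open>mat_adjoint A\<close>, hence the coefficient of
    \<open>x ^ 2 * y\<close> in the determinant.\<close>
  define M where "M = mat_trace (A * A * ?H) - mat_trace A * mat_trace (A * ?H) + e2 * cnj (mat_trace A)"
  note AA = mult_carrier_mat[OF A A]
  note H = mat_adjoint_carrier_square[OF A]
  note roots = sum_prod_roots_3[OF A ev]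
  have pow: "A ^\<^sub>m 2 = A * A" "A ^\<^sub>m 1 = A"
    using A by (simp_all add: numeral_2_eq_2)
  \<comment> \<open>The eigenvalue sums in \<open>D\<close> add up to the sum of
    \<open>l_i * cnj l_i * l_j\<close> over \<open>i\<close> different from \<open>j\<close>. This
    is \<open>e2 * cnj (l1 + l2 + l3)\<close> minus the three mixed products, which are the
    \<open>x ^ 2 * y\<close> coefficient for the diagonal matrix of eigenvalues.\<close>
  have D: "D = M - (l1 * l2 * cnj l3 + l1 * l3 * cnj l2 + l2 * l3 * cnj l1)"
    unfolding D_def M_def e2_def t_inv_def ev pow roots(1)[symmetric]
    by (simp add: algebra_simps power2_eq_square)
  note entries = mult_mat_index_3[OF A A] mult_mat_index_3[OF A H] mult_mat_index_3[OF AA H]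
    mat_adjoint_index[OF A] mat_trace_3[OF mult_carrier_mat[OF A H]]
    mat_trace_3[OF mult_carrier_mat[OF AA H]] mat_trace_3[OF A]
  have pencil: "x \<cdot>\<^sub>m A + y \<cdot>\<^sub>m ?H \<in> carrier_mat 3 3"
    using A H by auto
  have idx: "(x \<cdot>\<^sub>m A + y \<cdot>\<^sub>m ?H) $$ (i, j) = x * A $$ (i, j) + y * cnj (A $$ (j, i))"
    if "i < 3" "j < 3" for i j
    using that carrier_matD[OF A] carrier_matD[OF H] mat_adjoint_index[OF A] by simp
  \<comment> \<open>With \<open>e2\<close> rewritten as the sum of principal minors, both sides are
    polynomials in the entries and their conjugates.\<close>
  have "det (x \<cdot>\<^sub>m A + y \<cdot>\<^sub>m ?H) =
      x ^ 3 * det A + x ^ 2 * y * M + x * y ^ 2 * cnj M + y ^ 3 * cnj (det A)"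
    unfolding M_def e2_def roots(2) det_3[OF pencil] det_3[OF A]
    by (simp add: idx entries power2_eq_square power3_eq_cube) (simp add: algebra_simps)
  also have "\<dots> = (x * l1 + y * cnj l1) * (x * l2 + y * cnj l2) * (x * l3 + y * cnj l3)
    + x * y * (x * D + y * cnj D)"
    unfolding D roots(3)[symmetric]
    by (simp add: algebra_simps power2_eq_square power3_eq_cube)
  finally show ?thesis .
qed

text \<open>Once the products are expanded, every term that contains only powers of
  \<open>A\<close>, or only its adjoint, has a trace equal to the matching eigenvalue sum and
  cancels. Consequently \<open>t_inv 2 - mat_trace * t_inv 1\<close> grows by
  \<open>c * t_inv 1 A\<close>; when \<open>t_inv 1 A\<close> is nonzero, its only zero in
  \<open>c\<close> is the \<chi> of the theorem.\<close>

lemma t_inv_shift: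
  fixes c :: complex
  assumes A: "A \<in> carrier_mat 3 3" and ev: "eigenvals A = {#l1, l2, l3#}"
  defines "B \<equiv> A - c \<cdot>\<^sub>m 1\<^sub>m 3"
  shows "mat_trace B = mat_trace A - 3 * c"
    and "t_inv 1 B = t_inv 1 A"
    and "t_inv 2 B = t_inv 2 A - 2 * c * t_inv 1 A"
proof -
  have B: "B \<in> carrier_mat 3 3"
    using A unfolding B_def by auto
  have evB: "eigenvals B = {#l1 - c, l2 - c, l3 - c#}"
    unfolding B_def by (simp add: eigenvals_shift[OF A] ev)
  have pow: "X ^\<^sub>m 2 = X * X" "X ^\<^sub>m 1 = X" if "X \<in> carrier_mat 3 3" for X :: "complex mat"
    using that by (simp_all add: numeral_2_eq_2)
  note AA = mult_carrier_mat[OF A A] and BB = mult_carrier_mat[OF B B]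
  note HA = mat_adjoint_carrier_square[OF A] and HB = mat_adjoint_carrier_square[OF B]
  have idx: "B $$ (i, j) = A $$ (i, j) - (if i = j then c else 0)" if "i < 3" "j < 3" for i j
    using A that unfolding B_def by simp
  note entries = mult_mat_index_3[OF A A] mult_mat_index_3[OF A HA] mult_mat_index_3[OF AA HA]
    mult_mat_index_3[OF B B] mult_mat_index_3[OF B HB] mult_mat_index_3[OF BB HB]
    mat_adjoint_index[OF A] mat_adjoint_index[OF B]
    mat_trace_3[OF mult_carrier_mat[OF A HA]] mat_trace_3[OF mult_carrier_mat[OF AA HA]]
    mat_trace_3[OF mult_carrier_mat[OF B HB]] mat_trace_3[OF mult_carrier_mat[OF BB HB]]
    mat_trace_3[OF A] mat_trace_3[OF B] idx
  show "mat_trace B = mat_trace A - 3 * c"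
    by (simp add: entries)
  have trA: "mat_trace A = l1 + l2 + l3"
    using sum_prod_roots_3(1)[OF A ev] by simp
  \<comment> \<open>Newton's identity gives the trace of the square, which appears below as a
    coefficient of \<open>cnj c\<close>.\<close>
  have "l1 ^ 2 + l2 ^ 2 + l3 ^ 2 = (l1 + l2 + l3) ^ 2 - 2 * (l1 * l2 + l1 * l3 + l2 * l3)"
    by (simp add: algebra_simps power2_eq_square)
  also have "\<dots> = mat_trace (A * A)"
    unfolding sum_prod_roots_3[OF A ev] mat_trace_3[OF AA]
    by (simp add: entries algebra_simps power2_eq_square)
  finally have trAA: "mat_trace (A * A) = l1 ^ 2 + l2 ^ 2 + l3 ^ 2" ..
  have "mat_trace (B * mat_adjoint B) =
      mat_trace (A * mat_adjoint A) - c * cnj (mat_trace A) - cnj c * mat_trace A + 3 * c * cnj c"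
    by (simp add: entries algebra_simps)
  then show "t_inv 1 B = t_inv 1 A"
    unfolding t_inv_def evB ev pow(2)[OF A] pow(2)[OF B] trA
    by (simp add: algebra_simps)
  have "mat_trace (B * B * mat_adjoint B) =
      mat_trace (A * A * mat_adjoint A) - 2 * c * mat_trace (A * mat_adjoint A)
      + c ^ 2 * cnj (mat_trace A)
      - cnj c * (mat_trace (A * A) - 2 * c * mat_trace A + 3 * c ^ 2)"
    unfolding mat_trace_3[OF AA]
    by (simp add: entries algebra_simps power2_eq_square)
  then show "t_inv 2 B = t_inv 2 A - 2 * c * t_inv 1 A"
    unfolding t_inv_def evB ev pow[OF A] pow[OF B] trA trAA
    by (simp add: algebra_simps power2_eq_square)
qed

section \<open>Oriented lines, signed distances and the matrix p(A)\<close>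

text \<open>Rotation by -\<theta> makes the line through \<open>z\<close> horizontal, so the signed
  distance p(a) becomes an imaginary part.\<close>

lemma pedal_diff: "pedal z \<theta> - pedal a \<theta> = Im (cis (- \<theta>) * (a - z))"
  by (simp add: pedal_def algebra_simps)

lemma line_points_iff_pedal: "a \<in> line_points z \<theta> \<longleftrightarrow> pedal a \<theta> = pedal z \<theta>"
proof
  assume "a \<in> line_points z \<theta>"
  then obtain s where "a = z + complex_of_real s * cis \<theta>"
    unfolding line_points_def by auto
  then have "pedal z \<theta> - pedal a \<theta> = 0"
    unfolding pedal_diff by simp
  then show "pedal a \<theta> = pedal z \<theta>"
    by simp
next
  assume "pedal a \<theta> = pedal z \<theta>"
  then have *: "Im (cis (- \<theta>) * (a - z)) = 0"
    unfolding pedal_diff[symmetric] by simp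
  \<comment> \<open>After the rotation the real part is the coordinate of \<open>a\<close> along the
    line, measured from \<open>z\<close>.\<close>
  define s where "s = Re (cis (- \<theta>) * (a - z))"
  have "complex_of_real s = cis (- \<theta>) * (a - z)"
    using * unfolding s_def by (simp add: complex_eq_iff)
  then have "complex_of_real s * cis \<theta> = cis \<theta> * cis (- \<theta>) * (a - z)"
    by simp
  then have "a = z + complex_of_real s * cis \<theta>"
    by (simp add: cis_mult)
  then show "a \<in> line_points z \<theta>"
    unfolding line_points_def by auto
qed

text \<open>Matrix counterpart of \<open>pedal_diff\<close>: the scalar term of p(A) is absorbed by
  the translation to \<open>B\<close>, and what remains is the imaginary part of
  \<open>cis (- \<theta>)\<close> times \<open>B\<close>. This puts p(A) in the form of the
  pencil.\<close>

lemma pedal_mat_pencil: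
  fixes c :: complex
  assumes A: "A \<in> carrier_mat n n"
  defines "B \<equiv> A - c \<cdot>\<^sub>m 1\<^sub>m n"
  shows "pedal_mat (pedal c \<theta>) \<theta> A =
    (- \<i> / 2 * cis (- \<theta>)) \<cdot>\<^sub>m B + (\<i> / 2 * cis \<theta>) \<cdot>\<^sub>m mat_adjoint B"
proof (intro eq_matI)
  have B: "B \<in> carrier_mat n n"
    using A unfolding B_def by auto
  note HA = mat_adjoint_carrier_square[OF A] and HB = mat_adjoint_carrier_square[OF B]
  have half_i: "1 / (2 * \<i>) = - \<i> / 2"
    by (simp add: field_simps)
  fix i j
  assume "i < dim_row ((- \<i> / 2 * cis (- \<theta>)) \<cdot>\<^sub>m B + (\<i> / 2 * cis \<theta>) \<cdot>\<^sub>m mat_adjoint B)"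
    and "j < dim_col ((- \<i> / 2 * cis (- \<theta>)) \<cdot>\<^sub>m B + (\<i> / 2 * cis \<theta>) \<cdot>\<^sub>m mat_adjoint B)"
  then have ij: "i < n" "j < n"
    using HB by auto
  show "pedal_mat (pedal c \<theta>) \<theta> A $$ (i, j) =
    ((- \<i> / 2 * cis (- \<theta>)) \<cdot>\<^sub>m B + (\<i> / 2 * cis \<theta>) \<cdot>\<^sub>m mat_adjoint B) $$ (i, j)"
    using ij unfolding pedal_mat_def re_mat_def im_mat_def half_i
    by (auto simp: B_def carrier_matD[OF A] carrier_matD[OF HA] carrier_matD[OF HB[unfolded B_def]]
        mat_adjoint_index[OF A] mat_adjoint_index[OF B[unfolded B_def]] pedal_def
        complex_eq_iff field_simps)
qed (use A in \<open>auto simp: pedal_mat_def re_mat_def im_mat_def B_def mat_adjoint_def\<close>)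

theorem corollary60:
  fixes A :: "complex mat" and l1 l2 l3 \<chi> :: complex
  assumes "A \<in> carrier_mat 3 3"
    and "eigenvals A = {#l1, l2, l3#}"
    and "t_inv 1 A \<noteq> 0"
    and "\<chi> = mat_trace A - t_inv 2 A / t_inv 1 A"
  shows "(\<forall>l\<in>{l1, l2, l3}. \<forall>z \<theta>.
            \<chi> \<in> line_points z \<theta> \<and> l \<in> line_points z \<theta> \<longrightarrow> is_tangent A z \<theta>) \<and>
         (\<forall>z \<theta>. is_tangent A z \<theta> \<and> \<chi> \<in> line_points z \<theta> \<longrightarrow>
            (\<exists>l\<in>{l1, l2, l3}. l \<in> line_points z \<theta>))"
proof -
  define B where "B = A - \<chi> \<cdot>\<^sub>m 1\<^sub>m 3"
  have B: "B \<in> carrier_mat 3 3"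
    using assms(1) unfolding B_def by auto
  have evB: "eigenvals B = {#l1 - \<chi>, l2 - \<chi>, l3 - \<chi>#}"
    unfolding B_def by (simp add: eigenvals_shift[OF assms(1)] assms(2))
  \<comment> \<open>By the translation rules the left side is
    \<open>t_inv 2 A - mat_trace A * t_inv 1 A + \<chi> * t_inv 1 A\<close>, which the choice of
    \<chi> makes zero.\<close>
  have D: "t_inv 2 B - mat_trace B * t_inv 1 B = 0"
    using assms(3) unfolding B_def t_inv_shift[OF assms(1,2)] assms(4)
    by (simp add: field_simps)
  \<comment> \<open>The two claims of the theorem are the two directions of this equivalence for
    lines through \<chi>.\<close>
  have "is_tangent A z \<theta> \<longleftrightarrow> (\<exists>l\<in>{l1, l2, l3}. l \<in> line_points z \<theta>)"
    if z: "\<chi> \<in> line_points z \<theta>" for z \<theta>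
  proof -
    have pedal: "pedal z \<theta> = pedal \<chi> \<theta>"
      using z by (simp add: line_points_iff_pedal)
    \<comment> \<open>Each linear factor of the pencil determinant is the signed distance of one
      eigenvalue to the line, so a vanishing determinant puts some eigenvalue on the line.\<close>
    have factor: "- \<i> / 2 * cis (- \<theta>) * (l - \<chi>) + \<i> / 2 * cis \<theta> * cnj (l - \<chi>) =
        complex_of_real (pedal \<chi> \<theta> - pedal l \<theta>)" for l
      unfolding pedal_diff by (simp add: complex_eq_iff field_simps)
    have "det (pedal_mat (pedal z \<theta>) \<theta> A) =
        complex_of_real ((pedal \<chi> \<theta> - pedal l1 \<theta>) * (pedal \<chi> \<theta> - pedal l2 \<theta>) * (pedal \<chi> \<theta> - pedal l3 \<theta>))"
      unfolding pedal pedal_mat_pencil[OF assms(1)] B_def[symmetric]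
        det_pencil_adjoint[OF B evB] D
      by (simp only: factor mult_zero_right complex_cnj_zero add_0_right of_real_mult)
    moreover have "l \<in> line_points z \<theta> \<longleftrightarrow> pedal \<chi> \<theta> - pedal l \<theta> = 0" for l
      by (auto simp: line_points_iff_pedal pedal)
    ultimately show ?thesis
      unfolding is_tangent_def by auto
  qed
  then show ?thesis
    by blast
qed

end
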